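(* For every integer $c\ge1$, there is a graph $G$ with ${\sf bd}(G)\le c$ that contains an inclusion-wise minimal blocking set of size $2^c$.
   Context: All graphs are finite, undirected, simple. $\alpha(G)$ is the independence number; $Y\subseteq V(G)$ is a blocking set in $G$ if $\alpha(G\setminus Y)<\alpha(G)$. Bridge-depth: an edge is a bridge if its removal increases the number of connected components; $\bar G$ is obtained from $G$ by contracting all bridges; ${\sf bd}(G)=0$ for the empty graph, the maximum over components for disconnected $G$, and $1+\min_{v\in V(\bar G)}{\sf bd}(\bar G\setminus v)$ for connected nonempty $G$. *)

theory Defs
  imports "Graph_Theory.Digraph_Component" "Graph_Theory.Pair_Digraph"
begin

text \<open>
  A finite undirected simple graph is a \<^locale>\<open>pair_graph\<close>: finitely many vertices and a
  symmetric, irreflexive relation \<^const>\<open>parcs\<close> on them. An undirected edge \<open>uv\<close> is the pair of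
  arcs \<open>(u, v)\<close>, \<open>(v, u)\<close>. The null graph is allowed, and it is not \<^const>\<open>connected\<close>.
\<close>

definition induced_on :: "'a pair_pre_digraph \<Rightarrow> 'a set \<Rightarrow> 'a pair_pre_digraph" where
  "induced_on G S = \<lparr>pverts = pverts G \<inter> S, parcs = parcs G \<inter> S \<times> S\<rparr>"

definition delete_verts :: "'a pair_pre_digraph \<Rightarrow> 'a set \<Rightarrow> 'a pair_pre_digraph" where
  "delete_verts G Y = induced_on G (- Y)"

definition delete_edge :: "'a pair_pre_digraph \<Rightarrow> 'a \<Rightarrow> 'a \<Rightarrow> 'a pair_pre_digraph" where
  "delete_edge G u v = \<lparr>pverts = pverts G, parcs = parcs G - {(u, v), (v, u)}\<rparr>"


section \<open>Blocking sets\<close>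

definition independent_set :: "'a pair_pre_digraph \<Rightarrow> 'a set \<Rightarrow> bool" where
  "independent_set G S \<longleftrightarrow> S \<subseteq> pverts G \<and> (\<forall>u\<in>S. \<forall>v\<in>S. (u, v) \<notin> parcs G)"

definition independence_number :: "'a pair_pre_digraph \<Rightarrow> nat" where
  "independence_number G = Max (card ` {S. independent_set G S})"

definition blocking_set :: "'a pair_pre_digraph \<Rightarrow> 'a set \<Rightarrow> bool" where
  "blocking_set G Y \<longleftrightarrow>
     Y \<subseteq> pverts G \<and> independence_number (delete_verts G Y) < independence_number G"

definition minimal_blocking_set :: "'a pair_pre_digraph \<Rightarrow> 'a set \<Rightarrow> bool" where
  "minimal_blocking_set G Y \<longleftrightarrow> blocking_set G Y \<and> (\<forall>Z. Z \<subset> Y \<longrightarrow> \<not> blocking_set G Z)"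


section \<open>Bridges and their contraction\<close>

text \<open>For a symmetric digraph the strongly connected components are the connected components.\<close>

abbreviation components :: "'a pair_pre_digraph \<Rightarrow> 'a set set" where
  "components G \<equiv> pre_digraph.sccs_verts (with_proj G)"

definition bridges :: "'a pair_pre_digraph \<Rightarrow> ('a \<times> 'a) set" where
  "bridges G =
     {(u, v) \<in> parcs G. card (components G) < card (components (delete_edge G u v))}"

text \<open>
  Contracting a set \<open>F\<close> of edges identifies the vertices of each connected component of the
  spanning subgraph with edge set \<open>F\<close>. In order to stay within the type of the vertices, so that
  contraction can be iterated, a component is represented by one of its elements rather than
  by a new vertex; this determines the contracted graph up to isomorphism
  (see \<open>contract_rep_eq_iff\<close>). Loops and parallel edges are discarded.
\<close>

definition contract_rep :: "'a pair_pre_digraph \<Rightarrow> ('a \<times> 'a) set \<Rightarrow> 'a \<Rightarrow> 'a" where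
  "contract_rep G F v = (SOME u. u \<in> pre_digraph.scc_of (with_proj \<lparr>pverts = pverts G, parcs = F\<rparr>) v)"

definition contract_edges :: "'a pair_pre_digraph \<Rightarrow> ('a \<times> 'a) set \<Rightarrow> 'a pair_pre_digraph" where
  "contract_edges G F =
     \<lparr>pverts = contract_rep G F ` pverts G,
      parcs = {(contract_rep G F u, contract_rep G F v) | u v.
                 (u, v) \<in> parcs G \<and> contract_rep G F u \<noteq> contract_rep G F v}\<rparr>"

definition contract_bridges :: "'a pair_pre_digraph \<Rightarrow> 'a pair_pre_digraph" where
  "contract_bridges G = contract_edges G (bridges G)"

lemma scc_of_contract:
  "pre_digraph.scc_of (with_proj \<lparr>pverts = V, parcs = F\<rparr>) v =
     {u. v \<rightarrow>\<^sup>*\<^bsub>with_proj \<lparr>pverts = V, parcs = F\<rparr>\<^esub> u \<and> u \<rightarrow>\<^sup>*\<^bsub>with_proj \<lparr>pverts = V, parcs = F\<rparr>\<^esub> v}"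
  by (simp add: pre_digraph.scc_of_def)

lemma contract_rep_in_scc:
  assumes "v \<in> pverts G"
  shows "contract_rep G F v \<in> pre_digraph.scc_of (with_proj \<lparr>pverts = pverts G, parcs = F\<rparr>) v"
  unfolding contract_rep_def
  by (rule someI[of _ v]) (use assms in \<open>auto simp: scc_of_contract reachable_def\<close>)

lemma contract_rep_in_verts:
  assumes "v \<in> pverts G"
  shows "contract_rep G F v \<in> pverts G"
  using contract_rep_in_scc[OF assms, of F] by (auto simp: scc_of_contract elim: reachable_in_vertsE)

lemma contract_rep_eq_iff:
  assumes "u \<in> pverts G" "v \<in> pverts G"
  shows "contract_rep G F u = contract_rep G F v \<longleftrightarrow>
         v \<in> pre_digraph.scc_of (with_proj \<lparr>pverts = pverts G, parcs = F\<rparr>) u"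
proof -
  let ?H = "with_proj \<lparr>pverts = pverts G, parcs = F\<rparr>"
  have tr: "x \<rightarrow>\<^sup>*\<^bsub>?H\<^esub> z" if "x \<rightarrow>\<^sup>*\<^bsub>?H\<^esub> y" "y \<rightarrow>\<^sup>*\<^bsub>?H\<^esub> z" for x y z
    using that unfolding reachable_def by (rule rtrancl_on_trans)
  show ?thesis
  proof
    assume "contract_rep G F u = contract_rep G F v"
    then show "v \<in> pre_digraph.scc_of ?H u"
      using contract_rep_in_scc[OF assms(1), of F] contract_rep_in_scc[OF assms(2), of F]
      by (auto simp: scc_of_contract intro: tr)
  next
    assume "v \<in> pre_digraph.scc_of ?H u"
    then have "pre_digraph.scc_of ?H u = pre_digraph.scc_of ?H v"
      by (auto simp: scc_of_contract intro: tr)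
    then show "contract_rep G F u = contract_rep G F v"
      by (simp add: contract_rep_def)
  qed
qed

lemma pair_graph_iff:
  "pair_graph G \<longleftrightarrow> finite (pverts G) \<and> parcs G \<subseteq> pverts G \<times> pverts G \<and> sym (parcs G) \<and> irrefl (parcs G)"
proof
  assume "pair_graph G"
  then interpret pair_graph G .
  show "finite (pverts G) \<and> parcs G \<subseteq> pverts G \<times> pverts G \<and> sym (parcs G) \<and> irrefl (parcs G)"
    using pair_finite_verts wellformed' no_loops' arcs_symmetric
    by (auto simp: irrefl_def intro!: symI dest: no_loops')
next
  assume A: "finite (pverts G) \<and> parcs G \<subseteq> pverts G \<times> pverts G \<and> sym (parcs G) \<and> irrefl (parcs G)"
  then have "finite (parcs G)"
    by (meson finite_SigmaI finite_subset)
  with A show "pair_graph G"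
    by unfold_locales (auto simp: symmetric_def irrefl_def)
qed

lemma pair_graph_induced_on: "pair_graph G \<Longrightarrow> pair_graph (induced_on G S)"
  by (auto simp: pair_graph_iff induced_on_def sym_def irrefl_def)

lemma pair_graph_delete_verts: "pair_graph G \<Longrightarrow> pair_graph (delete_verts G Y)"
  by (simp add: delete_verts_def pair_graph_induced_on)

lemma pair_graph_delete_edge: "pair_graph G \<Longrightarrow> pair_graph (delete_edge G u v)"
  by (auto simp: pair_graph_iff delete_edge_def sym_def irrefl_def)

lemma pair_graph_contract_edges: "pair_graph G \<Longrightarrow> pair_graph (contract_edges G F)"
  unfolding pair_graph_iff contract_edges_def
  by (auto simp: irrefl_def intro!: symI) (metis symD)

lemma pair_graph_contract_bridges: "pair_graph G \<Longrightarrow> pair_graph (contract_bridges G)"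
  by (simp add: contract_bridges_def pair_graph_contract_edges)

lemma contract_bridges_subset: "pverts (contract_bridges G) \<subseteq> pverts G"
  by (auto simp: contract_bridges_def contract_edges_def contract_rep_in_verts)

lemma component_subset: "C \<in> components G \<Longrightarrow> C \<subseteq> pverts G"
  by (fastforce simp: pre_digraph.sccs_verts_def elim!: reachable_in_vertsE)

lemma component_psubset:
  assumes "pair_graph G" "\<not> connected (with_proj G)" "C \<in> components G"
  shows "C \<subset> pverts G"
proof -
  interpret pair_graph G by fact
  have "C \<noteq> pverts G"
  proof
    assume "C = pverts G"
    with assms(3) have "strongly_connected (with_proj G)"
      by (auto simp: pre_digraph.sccs_verts_def strongly_connected_def)
    then have "connected (with_proj G)"
      using reachable_mk_symmetric_eq[OF sym_arcs] by (auto simp: connected_def strongly_connected_def)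
    with assms(2) show False ..
  qed
  with component_subset[OF assms(3)] show ?thesis by blast
qed


section \<open>Bridge-depth\<close>

text \<open>The value outside of \<^const>\<open>pair_graph\<close> is immaterial.\<close>

function bridge_depth :: "'a pair_pre_digraph \<Rightarrow> nat" where
  "bridge_depth G =
     (if \<not> pair_graph G \<or> pverts G = {} then 0
      else if connected (with_proj G) then
        1 + Min ((\<lambda>v. bridge_depth (delete_verts (contract_bridges G) {v})) `
                   pverts (contract_bridges G))
      else Max ((\<lambda>C. bridge_depth (induced_on G C)) ` components G))"
  by pat_completeness auto

termination
proof (relation "measure (\<lambda>G. card (pverts G))", goal_cases)
  case 1
  show ?case by simp
next
  case (2 G v)
  then have "finite (pverts G)" by (simp add: pair_graph_iff)
  moreover have "pverts (delete_verts (contract_bridges G) {v}) \<subset> pverts G"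
    using 2 contract_bridges_subset[of G] by (auto simp: delete_verts_def induced_on_def)
  ultimately show ?case by (simp add: psubset_card_mono)
next
  case (3 G C)
  then have "finite (pverts G)" by (simp add: pair_graph_iff)
  moreover have "pverts (induced_on G C) \<subset> pverts G"
    using component_psubset[of G C] 3 by (auto simp: induced_on_def)
  ultimately show ?case by (simp add: psubset_card_mono)
qed

declare bridge_depth.simps [simp del]

end

theory Submission
  imports Defs
begin

text \<open>
  Induction on \<open>c\<close>, starting from the two ends of a single edge. Given disjoint graphs \<open>H\<^sub>1\<close>, \<open>H\<^sub>2\<close>
  with minimal blocking sets \<open>Y\<^sub>1\<close>, \<open>Y\<^sub>2\<close>, add an edge \<open>uv\<close> and join \<open>u\<close> to \<open>Y\<^sub>1\<close> and \<open>v\<close> to \<open>Y\<^sub>2\<close>.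
  Deleting all of \<open>Y\<^sub>i\<close> lowers the independence number of \<open>H\<^sub>i\<close> by exactly one; this loss is made up
  for by adding \<open>u\<close> or \<open>v\<close> to the independent set, but only one of them. Hence
  \<open>Y\<^sub>1 \<union> Y\<^sub>2\<close> is a minimal blocking set of the new graph. If moreover every component of \<open>H\<^sub>i\<close> minus
  an edge meets \<open>Y\<^sub>i\<close>, then \<open>uv\<close> is the only bridge of the new graph, and deleting the vertex
  it is contracted to leaves \<open>H\<^sub>1\<close> and \<open>H\<^sub>2\<close>, so the bridge-depth grows by at most one.
\<close>

section \<open>Independence and blocking\<close>

lemma independent_set_delete_verts:
  "independent_set (delete_verts G Z) S \<longleftrightarrow> independent_set G S \<and> S \<inter> Z = {}"
  by (simp add: independent_set_def delete_verts_def induced_on_def) blast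

lemma finite_independent_sets: "finite (pverts G) \<Longrightarrow> finite {S. independent_set G S}"
  by (rule finite_subset[of _ "Pow (pverts G)"]) (auto simp: independent_set_def)

lemma card_le_independence_number:
  assumes "finite (pverts G)" "independent_set G S"
  shows "card S \<le> independence_number G"
  unfolding independence_number_def
  using assms finite_independent_sets[OF assms(1)] by (intro Max_ge) auto

lemma obtain_maximum_independent_set:
  assumes "finite (pverts G)"
  obtains S where "independent_set G S" "card S = independence_number G"
proof -
  have "independent_set G {}" by (simp add: independent_set_def)
  then have "independence_number G \<in> card ` {S. independent_set G S}"
    unfolding independence_number_def
    using finite_independent_sets[OF assms] by (intro Max_in) auto
  then show ?thesis using that by auto
qed

text \<open>\<open>delete_verts G Z\<close> attains its independence number, so blocking can be
  tested on the single independent sets of \<open>G\<close>.\<close>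

lemma blocking_set_iff:
  assumes "finite (pverts G)"
  shows "blocking_set G Z \<longleftrightarrow> Z \<subseteq> pverts G \<and>
    (\<forall>S. independent_set G S \<and> S \<inter> Z = {} \<longrightarrow> card S < independence_number G)"
proof -
  have fin: "finite (pverts (delete_verts G Z))"
    using assms by (simp add: delete_verts_def induced_on_def)
  obtain M where "independent_set (delete_verts G Z) M"
    "card M = independence_number (delete_verts G Z)"
    using fin by (rule obtain_maximum_independent_set)
  then have "independence_number (delete_verts G Z) < independence_number G \<longleftrightarrow>
    (\<forall>S. independent_set (delete_verts G Z) S \<longrightarrow> card S < independence_number G)"
    using card_le_independence_number[OF fin] by (metis le_less_trans)
  then show ?thesis
    by (simp add: blocking_set_def independent_set_delete_verts)
qed

lemma minimal_blocking_set_proper_subset: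
  assumes "finite (pverts G)" "minimal_blocking_set G Y" "Z \<subset> Y"
  obtains S where "independent_set G S" "S \<inter> Z = {}" "card S = independence_number G"
proof -
  have "Z \<subseteq> pverts G" "\<not> blocking_set G Z"
    using assms by (auto simp: minimal_blocking_set_def blocking_set_def)
  then obtain S where "independent_set G S" "S \<inter> Z = {}" "\<not> card S < independence_number G"
    using assms(1) by (auto simp: blocking_set_iff)
  then show ?thesis
    using that[of S] card_le_independence_number[OF assms(1), of S] by simp
qed

text \<open>A maximum independent set that avoids all of \<open>Y\<close> except one vertex
  \<open>y\<close> meets \<open>Y\<close> at most in \<open>y\<close>, and dropping \<open>y\<close>
  costs at most one element.\<close>

lemma minimal_blocking_set_deficit_one:
  assumes "finite (pverts G)" "minimal_blocking_set G Y"
  obtains S where "independent_set G S" "S \<inter> Y = {}" "independence_number G \<le> card S + 1"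
proof -
  \<comment> \<open>The empty set never blocks: a maximum independent set avoids it.\<close>
  have "Y \<noteq> {}"
    using assms obtain_maximum_independent_set[OF assms(1)]
    by (metis Int_empty_right blocking_set_iff less_irrefl minimal_blocking_set_def)
  then obtain y where "y \<in> Y" by blast
  then have "Y - {y} \<subset> Y" by blast
  from minimal_blocking_set_proper_subset[OF assms this]
  obtain S where S: "independent_set G S" "S \<inter> (Y - {y}) = {}" "card S = independence_number G" .
  have "finite S"
    using S(1) assms(1) by (auto simp: independent_set_def intro: finite_subset)
  then have "card S \<le> card (S - {y}) + 1"
    using card.remove[of S y] by (cases "y \<in> S") auto
  then show ?thesis
    using S by (intro that[of "S - {y}"]) (auto simp: independent_set_def)
qed


section \<open>Connectivity\<close>

lemma sym_rtrancl_parcs: "pair_graph G \<Longrightarrow> sym ((parcs G)\<^sup>*)"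
  by (simp add: pair_graph_iff sym_rtrancl)

text \<open>Reachability is reflexive only on vertices, whereas \<open>(parcs G)\<^sup>*\<close>
  relates every point to itself; hence the condition on \<open>x\<close>.\<close>

lemma reachable_with_proj_iff:
  assumes "parcs G \<subseteq> pverts G \<times> pverts G"
  shows "x \<rightarrow>\<^sup>*\<^bsub>with_proj G\<^esub> y \<longleftrightarrow> x \<in> pverts G \<and> (x, y) \<in> (parcs G)\<^sup>*"
proof -
  interpret wf_digraph "with_proj G"
    using assms by unfold_locales (auto simp: with_proj_def)
  show ?thesis using reachable_conv'[of x y] by (auto elim: reachable_in_vertsE)
qed

text \<open>By symmetry of the arcs, reachability one way is already mutual, so strong components
  are plain reachability classes.\<close>

lemma components_eq:
  assumes "pair_graph G"
  shows "components G = (\<lambda>x. (parcs G)\<^sup>* `` {x}) ` pverts G"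
proof -
  interpret pair_graph G by fact
  have "pre_digraph.scc_of (with_proj G) x = (parcs G)\<^sup>* `` {x}" if "x \<in> pverts G" for x
  proof -
    have "y \<in> pverts G \<and> (y, x) \<in> (parcs G)\<^sup>*" if "(x, y) \<in> (parcs G)\<^sup>*" for y
      using that \<open>x \<in> pverts G\<close> sym_rtrancl_parcs[OF assms] assms
      by (auto simp: pair_graph_iff elim: rtranclE dest: symD)
    then show ?thesis
      using that assms by (auto simp: scc_of_def reachable_with_proj_iff pair_graph_iff)
  qed
  then show ?thesis
    by (simp add: sccs_verts_conv_scc_of)
qed

lemma connected_iff:
  assumes "pair_graph G"
  shows "connected (with_proj G) \<longleftrightarrow>
    pverts G \<noteq> {} \<and> (\<forall>x\<in>pverts G. \<forall>y\<in>pverts G. (x, y) \<in> (parcs G)\<^sup>*)"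
proof -
  interpret pair_graph G by fact
  show ?thesis
    using assms reachable_mk_symmetric_eq[OF sym_arcs]
    by (auto simp: connected_def strongly_connected_def reachable_with_proj_iff pair_graph_iff)
qed

lemma rtrancl_closed:
  assumes "(x, y) \<in> E\<^sup>*" "x \<in> A" "E `` A \<subseteq> A"
  shows "y \<in> A"
  using assms by (metis Image_closed_trancl Image_singleton_iff ImageI)

lemma components_connected:
  assumes "pair_graph G" "connected (with_proj G)"
  shows "components G = {pverts G}"
proof -
  have "(parcs G)\<^sup>* `` {x} = pverts G" if "x \<in> pverts G" for x
    using assms that rtrancl_closed[of x _ "parcs G" "pverts G"]
    by (auto simp: connected_iff pair_graph_iff)
  then show ?thesis
    using assms by (auto simp: components_eq connected_iff)
qed

text \<open>After the deletion there is exactly one component, and \<open>G\<close> has at least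
  one, so the number has not grown.\<close>

lemma not_bridge_connected_delete_edge:
  assumes "pair_graph G" "connected (with_proj (delete_edge G a b))"
  shows "(a, b) \<notin> bridges G"
proof -
  have "pverts G \<noteq> {}" "finite (pverts G)"
    using assms by (auto simp: connected_iff pair_graph_delete_edge delete_edge_def pair_graph_iff)
  then have "card (components G) \<ge> 1"
    using assms(1) by (simp add: components_eq Suc_le_eq card_gt_0_iff)
  moreover have "card (components (delete_edge G a b)) = 1"
    using assms by (simp add: components_connected pair_graph_delete_edge)
  ultimately show ?thesis by (simp add: bridges_def)
qed

lemma bridgeI:
  assumes "pair_graph G" "connected (with_proj G)" "(u, v) \<in> parcs G"
    and "(u, v) \<notin> (parcs (delete_edge G u v))\<^sup>*"
  shows "(u, v) \<in> bridges G"
proof -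
  let ?G = "delete_edge G u v"
  let ?C = "\<lambda>x. (parcs ?G)\<^sup>* `` {x}"
  have "u \<in> pverts ?G" "v \<in> pverts ?G" "finite (pverts ?G)"
    using assms(1,3) by (auto simp: pair_graph_iff delete_edge_def)
  then have "{?C u, ?C v} \<subseteq> components ?G" "finite (components ?G)"
    using assms(1) by (simp_all add: components_eq pair_graph_delete_edge)
  moreover have "?C u \<noteq> ?C v" using assms(4) by auto
  ultimately have "2 \<le> card (components ?G)"
    by (metis card_2_iff card_mono)
  then show ?thesis
    using assms by (simp add: bridges_def components_connected)
qed


section \<open>Bridge-depth\<close>

text \<open>If \<open>G\<close> were connected, its vertex set would be a component. So, unless
  \<open>G\<close> is the null graph, the maximum branch of the recursion applies.\<close>

lemma bridge_depth_le_components: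
  assumes "pair_graph G" "\<And>C. C \<in> components G \<Longrightarrow> C \<noteq> pverts G"
    "\<And>C. C \<in> components G \<Longrightarrow> bridge_depth (induced_on G C) \<le> d"
  shows "bridge_depth G \<le> d"
proof (cases "pverts G = {}")
  case True
  then show ?thesis by (subst bridge_depth.simps) simp
next
  case False
  have "finite (components G)" "components G \<noteq> {}"
    using assms(1) False by (simp_all add: components_eq pair_graph_iff)
  moreover have "\<not> connected (with_proj G)"
    using assms(1,2) components_connected by blast
  ultimately show ?thesis
    using assms False by (subst bridge_depth.simps) simp
qed

lemma bridge_depth_le_Suc:
  assumes "pair_graph G" "connected (with_proj G)" "w \<in> pverts (contract_bridges G)"
  shows "bridge_depth G \<le> Suc (bridge_depth (delete_verts (contract_bridges G) {w}))"
proof -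
  have "finite (pverts (contract_bridges G))"
    using assms(1) pair_graph_contract_bridges by (auto simp: pair_graph_iff)
  moreover have "pverts G \<noteq> {}" using assms(1,2) by (simp add: connected_iff)
  ultimately show ?thesis
    using assms by (subst bridge_depth.simps) (auto intro: Min_le)
qed

text \<open>Contraction merges \<open>u\<close> and \<open>v\<close> and keeps every other vertex as
  its own representative. Deleting the merged vertex thus yields
  \<open>delete_verts G {u, v}\<close> itself, not just an isomorphic copy, so the depths agree by
  equality.\<close>

lemma bridge_depth_single_bridge:
  assumes "pair_graph G" "connected (with_proj G)" "bridges G = {(u, v), (v, u)}"
  shows "bridge_depth G \<le> Suc (bridge_depth (delete_verts G {u, v}))"
proof -
  let ?F = "bridges G"
  let ?r = "contract_rep G ?F"
  let ?H = "\<lparr>pverts = pverts G, parcs = ?F\<rparr>"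
  have uv: "(u, v) \<in> parcs G" using assms(3) by (auto simp: bridges_def)
  then have verts: "u \<in> pverts G" "v \<in> pverts G" "u \<noteq> v"
    using assms(1) by (auto simp: pair_graph_iff irrefl_def)
  have H: "parcs ?H \<subseteq> pverts ?H \<times> pverts ?H" using verts assms(3) by simp
  have rep_other: "?r x = x" if "x \<in> pverts G" "x \<notin> {u, v}" for x
  proof -
    have "?r x \<in> pre_digraph.scc_of (with_proj ?H) x"
      using that(1) by (rule contract_rep_in_scc)
    then have "(x, ?r x) \<in> ?F\<^sup>*"
      using reachable_with_proj_iff[OF H] by (simp add: scc_of_contract)
    \<comment> \<open>No bridge leaves \<open>x\<close>, so \<open>{x}\<close> contains everything
      that \<open>x\<close> reaches.\<close>
    then show ?thesis
      using that rtrancl_closed[of x "?r x" ?F "{x}"] assms(3) by auto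
  qed
  have "(u, v) \<in> ?F\<^sup>*" "(v, u) \<in> ?F\<^sup>*" using assms(3) by auto
  then have rep_eq: "?r u = ?r v"
    using verts reachable_with_proj_iff[OF H] by (simp add: contract_rep_eq_iff scc_of_contract)
  have "?r u \<in> pre_digraph.scc_of (with_proj ?H) u"
    using verts by (simp add: contract_rep_in_scc)
  then have "(u, ?r u) \<in> ?F\<^sup>*"
    using reachable_with_proj_iff[OF H] by (simp add: scc_of_contract)
  \<comment> \<open>The choice by \<open>SOME\<close> leaves open which end represents the
    pair.\<close>
  then have rep_u: "?r u \<in> {u, v}"
    by (rule rtrancl_closed) (use assms(3) in auto)
  have rep_ne: "?r x \<noteq> ?r u \<longleftrightarrow> x \<notin> {u, v}" if "x \<in> pverts G" for x
    using that rep_other rep_eq rep_u by force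
  have pv: "pverts (delete_verts (contract_bridges G) {?r u}) = pverts (delete_verts G {u, v})"
    (is "?A = ?B")
  proof (intro equalityI subsetI)
    fix x assume "x \<in> ?A"
    then obtain a where "x = ?r a" "a \<in> pverts G" "x \<noteq> ?r u"
      by (auto simp: delete_verts_def induced_on_def contract_bridges_def contract_edges_def)
    with rep_ne rep_other show "x \<in> ?B" by (auto simp: delete_verts_def induced_on_def)
  next
    fix x assume "x \<in> ?B"
    then have "x \<in> pverts G" "x \<notin> {u, v}"
      by (auto simp: delete_verts_def induced_on_def)
    then have "x \<in> pverts G" "?r x = x" "x \<noteq> ?r u" using rep_ne rep_other by metis+
    then show "x \<in> ?A"
      by (auto simp: delete_verts_def induced_on_def contract_bridges_def contract_edges_def
          intro: image_eqI[where x = x])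
  qed
  have pa: "parcs (delete_verts (contract_bridges G) {?r u}) = parcs (delete_verts G {u, v})"
    (is "?A = ?B")
  proof (intro equalityI subrelI)
    fix x y assume "(x, y) \<in> ?A"
    then obtain a b where ab: "x = ?r a" "y = ?r b" "(a, b) \<in> parcs G" "x \<noteq> ?r u" "y \<noteq> ?r u"
      by (auto simp: delete_verts_def induced_on_def contract_bridges_def contract_edges_def)
    then have "a \<in> pverts G" "b \<in> pverts G" using assms(1) by (auto simp: pair_graph_iff)
    with ab rep_ne rep_other show "(x, y) \<in> ?B"
      by (auto simp: delete_verts_def induced_on_def)
  next
    fix x y assume "(x, y) \<in> ?B"
    then have xy: "(x, y) \<in> parcs G" "x \<notin> {u, v}" "y \<notin> {u, v}"
      by (auto simp: delete_verts_def induced_on_def)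
    then have in_G: "x \<in> pverts G" "y \<in> pverts G" "x \<noteq> y"
      using assms(1) by (auto simp: pair_graph_iff irrefl_def)
    with xy rep_other have "?r x = x" "?r y = y" by auto
    moreover from this have "x \<noteq> ?r u" "y \<noteq> ?r u"
      using rep_ne in_G xy by metis+
    moreover from calculation have "(x, y) \<in> parcs (contract_bridges G)"
      using xy(1) in_G(3) unfolding contract_bridges_def contract_edges_def
      by simp metis
    ultimately show "(x, y) \<in> ?A" by (simp add: delete_verts_def induced_on_def)
  qed
  have "delete_verts (contract_bridges G) {?r u} = delete_verts G {u, v}"
    using pv pa by simp
  moreover have "?r u \<in> pverts (contract_bridges G)"
    using verts by (simp add: contract_bridges_def contract_edges_def)
  ultimately show ?thesis
    using bridge_depth_le_Suc[OF assms(1,2)] by metis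
qed


section \<open>Anchored sets\<close>

text \<open>
  When \<open>a\<close> and \<open>b\<close> are not adjacent, \<open>delete_edge\<close> leaves the graph unchanged, so the last
  condition also makes sense for arbitrary \<open>a\<close> and \<open>b\<close>.
\<close>

definition anchored :: "'a pair_pre_digraph \<Rightarrow> 'a set \<Rightarrow> bool" where
  "anchored G Y \<longleftrightarrow> Y \<subseteq> pverts G \<and> connected (with_proj G) \<and>
     (\<forall>a b. \<forall>x\<in>pverts G. \<exists>y\<in>Y. (x, y) \<in> (parcs (delete_edge G a b))\<^sup>*)"

text \<open>If the deleted edge meets \<open>r\<close>, then \<open>H\<close> is intact and one of
  the at least two edges from \<open>Y\<close> to \<open>r\<close> is spared. Otherwise the
  anchoring still leads \<open>x\<close> to \<open>Y\<close>, and all edges from \<open>Y\<close> to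
  \<open>r\<close> remain.\<close>

lemma anchored_reaches_apex:
  assumes "pair_graph H" "anchored H Y" "2 \<le> card Y" "r \<notin> pverts H" "x \<in> pverts H"
    and "parcs H \<subseteq> E" "Y \<times> {r} \<subseteq> E"
  shows "(x, r) \<in> (E - {(a, b), (b, a)})\<^sup>*"
proof -
  have "\<exists>y\<in>Y. (x, y) \<in> (E - {(a, b), (b, a)})\<^sup>* \<and> (y, r) \<in> E - {(a, b), (b, a)}"
  proof (cases "r \<in> {a, b}")
    case True
    \<comment> \<open>Besides \<open>r\<close>, the pair \<open>{a, b}\<close> has at most one
      element, too few to cover \<open>Y\<close>.\<close>
    have "\<not> Y \<subseteq> {a, b} - {r}"
    proof
      assume "Y \<subseteq> {a, b} - {r}"
      then have "card Y \<le> card ({a, b} - {r})" by (intro card_mono) auto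
      also have "\<dots> \<le> 1" using True by (auto simp: card_insert_if)
      finally show False using assms(3) by simp
    qed
    then obtain y where y: "y \<in> Y" "y \<notin> {a, b} - {r}" by blast
    have "y \<in> pverts H" "y \<noteq> r" using y assms(2,4) by (auto simp: anchored_def)
    then have "(x, y) \<in> (parcs H)\<^sup>*"
      using assms(1,2,5) by (simp add: anchored_def connected_iff)
    moreover have "parcs H \<subseteq> E - {(a, b), (b, a)}"
      using True assms(1,4,6) by (auto simp: pair_graph_iff)
    ultimately have "(x, y) \<in> (E - {(a, b), (b, a)})\<^sup>*"
      by (meson rtrancl_mono subsetD)
    then show ?thesis using y \<open>y \<noteq> r\<close> assms(7) by auto
  next
    case False
    obtain y where y: "y \<in> Y" "(x, y) \<in> (parcs (delete_edge H a b))\<^sup>*"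
      using assms(2,5) unfolding anchored_def by blast
    moreover have "parcs (delete_edge H a b) \<subseteq> E - {(a, b), (b, a)}"
      using assms(6) by (auto simp: delete_edge_def)
    ultimately have "(x, y) \<in> (E - {(a, b), (b, a)})\<^sup>*"
      by (meson rtrancl_mono subsetD)
    then show ?thesis using y(1) False assms(7) by auto
  qed
  then show ?thesis by (meson rtrancl.rtrancl_into_rtrancl)
qed


section \<open>Joining two graphs by a bridge\<close>

definition bridge_join ::
  "'a pair_pre_digraph \<Rightarrow> 'a set \<Rightarrow> 'a \<Rightarrow> 'a \<Rightarrow> 'a set \<Rightarrow> 'a pair_pre_digraph \<Rightarrow> 'a pair_pre_digraph"
  where
  "bridge_join H Y u v Z K =
     \<lparr>pverts = {u, v} \<union> pverts H \<union> pverts K,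
      parcs = parcs H \<union> parcs K \<union> Y \<times> {u} \<union> {u} \<times> Y \<union> Z \<times> {v} \<union> {v} \<times> Z \<union> {(u, v), (v, u)}\<rparr>"

lemma bridge_join_commute: "bridge_join H Y u v Z K = bridge_join K Z v u Y H"
  by (auto simp: bridge_join_def)

text \<open>Both graphs satisfy the invariant of the later induction. Having two anchors on each
  side keeps the edges from \<open>u\<close> into \<open>Y\<close> and from \<open>v\<close> into
  \<open>Z\<close> from being bridges.\<close>

locale joinable =
  fixes H :: "'a pair_pre_digraph" and Y u v Z and K :: "'a pair_pre_digraph"
  assumes H: "pair_graph H" "minimal_blocking_set H Y" "anchored H Y" "2 \<le> card Y"
    and K: "pair_graph K" "minimal_blocking_set K Z" "anchored K Z" "2 \<le> card Z"
    and disjoint: "pverts H \<inter> pverts K = {}" "{u, v} \<inter> (pverts H \<union> pverts K) = {}" "u \<noteq> v"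
begin

abbreviation (input) J where "J \<equiv> bridge_join H Y u v Z K"

lemma subsets: "Y \<subseteq> pverts H" "Z \<subseteq> pverts K" "parcs H \<subseteq> pverts H \<times> pverts H"
  "parcs K \<subseteq> pverts K \<times> pverts K"
  using H K by (simp_all add: anchored_def pair_graph_iff)

lemma pair_graph_J: "pair_graph J"
  using H(1) K(1) subsets disjoint
  unfolding pair_graph_iff by (auto simp: bridge_join_def irrefl_def sym_def)

text \<open>Facts about the side of \<open>H\<close> carry over to \<open>K\<close> by interpreting
  the locale with its parameters reversed.\<close>

lemma commuted: "joinable K Z v u Y H"
  using H K disjoint by (intro joinable.intro) auto

section \<open>Independence number of the join\<close>

lemma independence_number_J_ge: "independence_number H + independence_number K \<le> independence_number J"
proof -
  obtain S where S: "independent_set H S" "card S = independence_number H"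
    using H(1) obtain_maximum_independent_set by (auto simp: pair_graph_iff)
  obtain T where T: "independent_set K T" "card T = independence_number K"
    using K(1) obtain_maximum_independent_set by (auto simp: pair_graph_iff)
  \<comment> \<open>\<open>J\<close> has no edge between \<open>H\<close> and
    \<open>K\<close>.\<close>
  have "independent_set J (S \<union> T)"
    using S(1) T(1) subsets disjoint by (auto simp: independent_set_def bridge_join_def)
  moreover have "card (S \<union> T) = card S + card T"
    using S(1) T(1) disjoint(1) H(1) K(1)
    by (intro card_Un_disjoint)
      (auto simp: independent_set_def pair_graph_iff intro: finite_subset)
  ultimately show ?thesis
    using S T pair_graph_J card_le_independence_number[of J "S \<union> T"] by (simp add: pair_graph_iff)
qed

lemma independent_set_restrict:
  assumes "independent_set J S"
  shows "independent_set H (S \<inter> pverts H)"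
  using assms by (auto simp: independent_set_def bridge_join_def)

lemma card_independent_set_J:
  assumes "independent_set J S"
  shows "card S = card (S \<inter> pverts H) + card (S \<inter> pverts K) + card (S \<inter> {u, v})"
    and "card (S \<inter> {u, v}) \<le> 1"
proof -
  have fin: "finite (pverts H)" "finite (pverts K)" using H K by (simp_all add: pair_graph_iff)
  have "S = (S \<inter> pverts H \<union> S \<inter> pverts K) \<union> S \<inter> {u, v}"
    using assms by (auto simp: independent_set_def bridge_join_def)
  also have "card \<dots> = card (S \<inter> pverts H \<union> S \<inter> pverts K) + card (S \<inter> {u, v})"
    using fin disjoint by (intro card_Un_disjoint) auto
  also have "card (S \<inter> pverts H \<union> S \<inter> pverts K) = card (S \<inter> pverts H) + card (S \<inter> pverts K)"
    using fin disjoint by (intro card_Un_disjoint) auto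
  finally show "card S = card (S \<inter> pverts H) + card (S \<inter> pverts K) + card (S \<inter> {u, v})" .
  have "u \<notin> S \<or> v \<notin> S" using assms by (auto simp: independent_set_def bridge_join_def)
  then have "S \<inter> {u, v} \<subseteq> {u} \<or> S \<inter> {u, v} \<subseteq> {v}" by blast
  then show "card (S \<inter> {u, v}) \<le> 1" using card_mono[of "{_}" "S \<inter> {u, v}"] by fastforce
qed

lemma card_independent_set_H:
  assumes "independent_set J S"
  shows "card (S \<inter> pverts H) \<le> independence_number H"
    and "S \<inter> Y = {} \<Longrightarrow> card (S \<inter> pverts H) < independence_number H"
proof -
  have fin: "finite (pverts H)" using H(1) by (simp add: pair_graph_iff)
  show "card (S \<inter> pverts H) \<le> independence_number H"
    using fin independent_set_restrict[OF assms] by (rule card_le_independence_number)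
  have "blocking_set H Y" using H(2) by (simp add: minimal_blocking_set_def)
  moreover assume "S \<inter> Y = {}"
  ultimately show "card (S \<inter> pverts H) < independence_number H"
    using independent_set_restrict[OF assms] by (auto simp: blocking_set_iff[OF fin])
qed

lemma card_independent_set_K:
  assumes "independent_set J S"
  shows "card (S \<inter> pverts K) \<le> independence_number K"
    and "S \<inter> Z = {} \<Longrightarrow> card (S \<inter> pverts K) < independence_number K"
proof -
  interpret K: joinable K Z v u Y H by (rule commuted)
  show "card (S \<inter> pverts K) \<le> independence_number K"
    "S \<inter> Z = {} \<Longrightarrow> card (S \<inter> pverts K) < independence_number K"
    using K.card_independent_set_H[of S] assms by (simp_all add: bridge_join_commute)
qed

text \<open>For the upper bound, \<open>u\<close> or \<open>v\<close> in \<open>S\<close> adds one,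
  but keeps \<open>S\<close> off \<open>Y\<close> or \<open>Z\<close>; as these block, the part of
  \<open>S\<close> in \<open>H\<close> or \<open>K\<close> falls short by at least one.\<close>

lemma independence_number_J: "independence_number J = independence_number H + independence_number K"
proof (rule antisym)
  obtain S where S: "independent_set J S" "card S = independence_number J"
    using pair_graph_J obtain_maximum_independent_set by (auto simp: pair_graph_iff)
  note b = card_independent_set_J[OF S(1)] card_independent_set_H[OF S(1)]
    card_independent_set_K[OF S(1)]
  consider "u \<in> S" | "v \<in> S" | "S \<inter> {u, v} = {}" by blast
  then have "card S \<le> independence_number H + independence_number K"
  proof cases
    case 1
    then have "S \<inter> Y = {}" using S(1) by (auto simp: independent_set_def bridge_join_def)
    with b show ?thesis by linarith
  next
    case 2
    then have "S \<inter> Z = {}" using S(1) by (auto simp: independent_set_def bridge_join_def)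
    with b show ?thesis by linarith
  next
    case 3
    then have "card (S \<inter> {u, v}) = 0" by simp
    with b show ?thesis by linarith
  qed
  then show "independence_number J \<le> independence_number H + independence_number K"
    using S(2) by simp
qed (rule independence_number_J_ge)

section \<open>The minimal blocking set of the join\<close>

lemma blocking_set_J: "blocking_set J (Y \<union> Z)"
proof -
  have "card S < independence_number J" if "independent_set J S" "S \<inter> (Y \<union> Z) = {}" for S
  proof -
    from that(2) have "S \<inter> Y = {}" "S \<inter> Z = {}" by auto
    \<comment> \<open>Both sides lose at least one, while the adjacent \<open>u\<close> and
      \<open>v\<close> together regain at most one.\<close>
    with card_independent_set_J[OF that(1)] card_independent_set_H(2)[OF that(1)]
      card_independent_set_K(2)[OF that(1)] show ?thesis
      by (simp add: independence_number_J)
  qed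
  moreover have "Y \<union> Z \<subseteq> pverts J" using subsets by (auto simp: bridge_join_def)
  moreover have "finite (pverts J)" using pair_graph_J by (simp add: pair_graph_iff)
  ultimately show ?thesis by (simp add: blocking_set_iff)
qed

text \<open>Minimality of \<open>Y\<close> gives a maximum independent set of \<open>H\<close> that
  avoids \<open>X\<close>. In \<open>K\<close>, giving up all of \<open>Z\<close> costs at most one
  element, and \<open>v\<close> makes up for it.\<close>

lemma not_blocking_if_misses_Y:
  assumes "X \<subseteq> Y \<union> Z" "\<not> Y \<subseteq> X"
  shows "\<not> blocking_set J X"
proof -
  have fin: "finite (pverts H)" "finite (pverts K)" "finite (pverts J)"
    using H(1) K(1) pair_graph_J by (simp_all add: pair_graph_iff)
  have "X \<inter> Y \<subset> Y" using assms(2) by blast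
  from minimal_blocking_set_proper_subset[OF fin(1) H(2) this]
  obtain S where S: "independent_set H S" "S \<inter> (X \<inter> Y) = {}" "card S = independence_number H" .
  from minimal_blocking_set_deficit_one[OF fin(2) K(2)]
  obtain T where T: "independent_set K T" "T \<inter> Z = {}" "independence_number K \<le> card T + 1" .
  have sub: "S \<subseteq> pverts H" "T \<subseteq> pverts K" using S T by (auto simp: independent_set_def)
  then have finS: "finite S" "finite T" using fin finite_subset by blast+
  \<comment> \<open>\<open>v\<close> is adjacent only to \<open>u\<close> and \<open>Z\<close>, so
    it is compatible with \<open>S\<close> even where \<open>S\<close> meets
    \<open>Y\<close>.\<close>
  have "independent_set J (insert v (S \<union> T))"
    using S(1) T(1,2) subsets disjoint by (auto simp: independent_set_def bridge_join_def)
  moreover have "insert v (S \<union> T) \<inter> X = {}"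
    using assms(1) S(2) T(2) sub subsets disjoint by blast
  moreover have "card (insert v (S \<union> T)) = card S + card T + 1"
  proof -
    have "card (S \<union> T) = card S + card T"
      using sub disjoint(1) finS by (intro card_Un_disjoint) auto
    moreover have "v \<notin> S \<union> T" using sub disjoint by blast
    ultimately show ?thesis using finS by simp
  qed
  ultimately show ?thesis
    using S(3) T(3) independence_number_J blocking_set_iff[OF fin(3), of X]
    by (metis add.assoc add_left_mono not_less)
qed

lemma minimal_blocking_set_J: "minimal_blocking_set J (Y \<union> Z)"
proof -
  interpret K: joinable K Z v u Y H by (rule commuted)
  have "\<not> blocking_set J X" if "X \<subset> Y \<union> Z" for X
  proof (cases "Y \<subseteq> X")
    case False
    then show ?thesis using that not_blocking_if_misses_Y by blast
  next
    case True
    with that have "X \<subseteq> Z \<union> Y" "\<not> Z \<subseteq> X" by blast+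
    then show ?thesis using K.not_blocking_if_misses_Y by (simp add: bridge_join_commute)
  qed
  then show ?thesis by (simp add: minimal_blocking_set_def blocking_set_J)
qed

section \<open>Connectivity and bridges of the join\<close>

lemma reaches_u:
  assumes "x \<in> insert u (pverts H)"
  shows "(x, u) \<in> (parcs (delete_edge J a b))\<^sup>*"
proof (cases "x = u")
  case False
  then show ?thesis
    using anchored_reaches_apex[OF H(1,3,4), of u x "parcs J" a b] assms disjoint
    by (auto simp: bridge_join_def delete_edge_def)
qed simp

lemma reaches_v:
  assumes "x \<in> insert v (pverts K)"
  shows "(x, v) \<in> (parcs (delete_edge J a b))\<^sup>*"
proof -
  interpret K: joinable K Z v u Y H by (rule commuted)
  show ?thesis using K.reaches_u[OF assms] by (simp add: bridge_join_commute)
qed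

text \<open>All vertices still reach \<open>u\<close> or \<open>v\<close>, and the edge between
  these two survives.\<close>

lemma connected_delete_edge_J:
  assumes "{a, b} \<noteq> {u, v}"
  shows "connected (with_proj (delete_edge J a b))"
proof -
  let ?E = "parcs (delete_edge J a b)"
  have pg: "pair_graph (delete_edge J a b)" by (simp add: pair_graph_J pair_graph_delete_edge)
  have "(v, u) \<in> ?E" using assms by (auto simp: bridge_join_def delete_edge_def)
  then have "(x, u) \<in> ?E\<^sup>*" if "x \<in> pverts J" for x
    using that reaches_u[of x a b] reaches_v[of x a b]
    by (auto simp: bridge_join_def intro: rtrancl.rtrancl_into_rtrancl)
  then have "(x, y) \<in> ?E\<^sup>*" if "x \<in> pverts J" "y \<in> pverts J" for x y
    using that sym_rtrancl_parcs[OF pg] by (meson rtrancl_trans symD)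
  moreover have "pverts J \<noteq> {}" by (simp add: bridge_join_def)
  ultimately show ?thesis
    by (simp add: connected_iff[OF pg]) (simp add: delete_edge_def)
qed

lemma connected_J: "connected (with_proj J)"
proof -
  \<comment> \<open>There is no loop at \<open>u\<close>, so deleting \<open>uu\<close> changes
    nothing and the previous lemma applies to \<open>J\<close> itself.\<close>
  have "{u} \<noteq> {u, v}" using disjoint by auto
  then have "connected (with_proj (delete_edge J u u))"
    by (intro connected_delete_edge_J) auto
  moreover have "(u, u) \<notin> parcs J" using pair_graph_J by (auto simp: pair_graph_iff irrefl_def)
  then have "delete_edge J u u = J" by (simp add: delete_edge_def)
  ultimately show ?thesis by simp
qed

text \<open>Each side keeps its own anchors, so this survives even the deletion of
  \<open>uv\<close>, which disconnects \<open>J\<close>.\<close>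

lemma anchored_J: "anchored J (Y \<union> Z)"
  unfolding anchored_def
proof (intro conjI allI ballI)
  show sub: "Y \<union> Z \<subseteq> pverts J" using subsets by (auto simp: bridge_join_def)
  fix a b x assume x: "x \<in> pverts J"
  let ?G = "delete_edge J a b"
  have pg: "pair_graph ?G" by (simp add: pair_graph_J pair_graph_delete_edge)
  have "card Y \<noteq> 0" "card Z \<noteq> 0" using H(4) K(4) by auto
  then obtain y z where yz: "y \<in> Y" "z \<in> Z" by (metis card.empty ex_in_conv)
  have "(y, u) \<in> (parcs ?G)\<^sup>*" "(z, v) \<in> (parcs ?G)\<^sup>*"
    using yz subsets by (auto intro!: reaches_u reaches_v)
  then have "(u, y) \<in> (parcs ?G)\<^sup>*" "(v, z) \<in> (parcs ?G)\<^sup>*"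
    using sym_rtrancl_parcs[OF pg] by (meson symD)+
  moreover have "(x, u) \<in> (parcs ?G)\<^sup>* \<or> (x, v) \<in> (parcs ?G)\<^sup>*"
    using x reaches_u[of x a b] reaches_v[of x a b] by (auto simp: bridge_join_def)
  ultimately show "\<exists>y\<in>Y \<union> Z. (x, y) \<in> (parcs ?G)\<^sup>*"
    using yz by (meson UnI1 UnI2 rtrancl_trans)
qed (rule connected_J)

lemma uv_bridge_J: "(u, v) \<in> bridges J"
proof (rule bridgeI[OF pair_graph_J connected_J])
  show "(u, v) \<in> parcs J" by (simp add: bridge_join_def)
  \<comment> \<open>Without \<open>uv\<close>, no arc leaves the side of \<open>u\<close>.\<close>
  have "parcs (delete_edge J u v) `` insert u (pverts H) \<subseteq> insert u (pverts H)"
    using subsets disjoint by (auto simp: bridge_join_def delete_edge_def)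
  then show "(u, v) \<notin> (parcs (delete_edge J u v))\<^sup>*"
    using rtrancl_closed[of u v _ "insert u (pverts H)"] disjoint by auto
qed

lemma bridges_J: "bridges J = {(u, v), (v, u)}"
proof
  show "bridges J \<subseteq> {(u, v), (v, u)}"
  proof (rule subrelI)
    fix a b assume "(a, b) \<in> bridges J"
    then have "{a, b} = {u, v}"
      using not_bridge_connected_delete_edge[OF pair_graph_J] connected_delete_edge_J by blast
    then show "(a, b) \<in> {(u, v), (v, u)}" by (auto simp: doubleton_eq_iff)
  qed
  interpret K: joinable K Z v u Y H by (rule commuted)
  show "{(u, v), (v, u)} \<subseteq> bridges J"
    using uv_bridge_J K.uv_bridge_J by (simp add: bridge_join_commute)
qed

section \<open>Bridge-depth of the join\<close>

lemma bridge_depth_J: "bridge_depth J \<le> Suc (max (bridge_depth H) (bridge_depth K))"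
proof -
  let ?D = "delete_verts J {u, v}"
  have pg: "pair_graph ?D" by (simp add: pair_graph_J pair_graph_delete_verts)
  have D: "pverts ?D = pverts H \<union> pverts K" "parcs ?D = parcs H \<union> parcs K"
    using subsets disjoint by (auto simp: bridge_join_def delete_verts_def induced_on_def)
  have "parcs K \<inter> pverts H \<times> pverts H = {}" "parcs H \<inter> pverts K \<times> pverts K = {}"
    using subsets disjoint(1) by blast+
  then have induced: "induced_on ?D (pverts H) = H" "induced_on ?D (pverts K) = K"
    using D subsets disjoint(1) by (auto simp: induced_on_def intro!: pair_pre_digraph.equality)
  have nonempty: "pverts H \<noteq> {}" "pverts K \<noteq> {}"
    using H(1,3) K(1,3) by (simp_all add: anchored_def connected_iff)
  \<comment> \<open>\<open>H\<close> and \<open>K\<close> are connected and closed under the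
    remaining arcs, so a reachability class is one whole side.\<close>
  have components: "C \<in> {pverts H, pverts K}" if C: "C \<in> components ?D" for C
  proof -
    obtain x where x: "x \<in> pverts ?D" "C = (parcs ?D)\<^sup>* `` {x}"
      using C components_eq[OF pg] by auto
    have sup: "(parcs H)\<^sup>* \<subseteq> (parcs ?D)\<^sup>*" "(parcs K)\<^sup>* \<subseteq> (parcs ?D)\<^sup>*"
      by (simp_all add: D rtrancl_mono)
    have closed: "parcs ?D `` pverts H \<subseteq> pverts H" "parcs ?D `` pverts K \<subseteq> pverts K"
      using D subsets disjoint by auto
    from x(1) D consider "x \<in> pverts H" | "x \<in> pverts K" by auto
    then show ?thesis
    proof cases
      case 1
      then have "C = pverts H"
        using x(2) sup(1) H(1,3) rtrancl_closed[OF _ 1 closed(1)]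
        by (auto simp: anchored_def connected_iff)
      then show ?thesis by simp
    next
      case 2
      then have "C = pverts K"
        using x(2) sup(2) K(1,3) rtrancl_closed[OF _ 2 closed(2)]
        by (auto simp: anchored_def connected_iff)
      then show ?thesis by simp
    qed
  qed
  have "bridge_depth ?D \<le> max (bridge_depth H) (bridge_depth K)"
    using pg
  proof (rule bridge_depth_le_components)
    fix C assume "C \<in> components ?D"
    note C = components[OF this]
    show "C \<noteq> pverts ?D" using C D nonempty disjoint(1) by blast
    show "bridge_depth (induced_on ?D C) \<le> max (bridge_depth H) (bridge_depth K)"
      using C induced by auto
  qed
  then show ?thesis
    using bridge_depth_single_bridge[OF pair_graph_J connected_J bridges_J] by simp
qed

end


section \<open>Existence\<close>

text \<open>Base of the induction: either end alone is a maximum independent set, so a blocking set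
  must contain both.\<close>

lemma single_edge:
  assumes "u \<noteq> v"
  defines "G \<equiv> \<lparr>pverts = {u, v}, parcs = {(u, v), (v, u)}\<rparr>"
  shows "pair_graph G" "minimal_blocking_set G {u, v}" "anchored G {u, v}" "bridge_depth G \<le> 1"
proof -
  show pg: "pair_graph G"
    using assms by (auto simp: pair_graph_iff sym_def irrefl_def)
  have fin: "finite (pverts G)" and verts: "pverts G = {u, v}" by (simp_all add: G_def)
  have indep: "independent_set G S \<longleftrightarrow> S = {} \<or> S = {u} \<or> S = {v}" for S
    using assms by (auto simp: independent_set_def)
  then have "{S. independent_set G S} = {{}, {u}, {v}}" by auto
  then have alpha: "independence_number G = 1" by (simp add: independence_number_def)
  show "minimal_blocking_set G {u, v}"
    unfolding minimal_blocking_set_def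
  proof (intro conjI allI impI)
    have "card S < 1" if "independent_set G S" "S \<inter> {u, v} = {}" for S
    proof -
      have "S = {}" using that verts by (auto simp: independent_set_def)
      then show ?thesis by simp
    qed
    then show "blocking_set G {u, v}" by (simp add: blocking_set_iff[OF fin] alpha verts)
    fix Z assume "Z \<subset> {u, v}"
    then obtain w where w: "w \<in> {u, v}" "w \<notin> Z" by blast
    then have "independent_set G {w}" using indep by auto
    moreover have "{w} \<inter> Z = {}" "card {w} = 1" using w(2) by simp_all
    ultimately show "\<not> blocking_set G Z"
      unfolding blocking_set_iff[OF fin] alpha by (metis less_irrefl)
  qed
  have "(u, v) \<in> (parcs G)\<^sup>*" "(v, u) \<in> (parcs G)\<^sup>*" by (auto simp: G_def)
  then have conn: "connected (with_proj G)"
    using connected_iff[OF pg] by (auto simp: G_def)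
  \<comment> \<open>Every vertex is its own anchor, whatever edge is deleted.\<close>
  then show "anchored G {u, v}"
    by (auto simp: anchored_def G_def)
  have "(u, v) \<in> bridges G"
    using pg conn assms by (intro bridgeI) (auto simp: delete_edge_def)
  moreover have "(v, u) \<in> bridges G"
    using pg conn assms by (intro bridgeI) (auto simp: delete_edge_def insert_commute)
  ultimately have "bridges G = {(u, v), (v, u)}"
    by (auto simp: bridges_def G_def)
  \<comment> \<open>The null graph has depth 0, which makes the bound 1.\<close>
  moreover have "bridge_depth (delete_verts G {u, v}) = 0"
    by (subst bridge_depth.simps) (simp add: delete_verts_def induced_on_def G_def)
  ultimately show "bridge_depth G \<le> 1"
    using bridge_depth_single_bridge[OF pg conn, of u v] by simp
qed

text \<open>
  Avoiding an arbitrary finite set provides disjoint copies without renaming vertices.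
\<close>

lemma exists_anchored_blocking_graph:
  fixes F :: "'a set"
  assumes "infinite (UNIV :: 'a set)" "finite F"
  shows "\<exists>(G :: 'a pair_pre_digraph) Y. pair_graph G \<and> pverts G \<inter> F = {} \<and>
    bridge_depth G \<le> Suc c \<and> minimal_blocking_set G Y \<and> anchored G Y \<and> card Y = 2 ^ Suc c"
  using assms(2)
proof (induction c arbitrary: F)
  case 0
  obtain u where u: "u \<notin> F" using ex_new_if_finite[OF assms(1) 0] by blast
  obtain v where v: "v \<notin> insert u F"
    using ex_new_if_finite[OF assms(1), of "insert u F"] 0 by blast
  then show ?case
    using u single_edge[of u v]
    by (intro exI[of _ "\<lparr>pverts = {u, v}, parcs = {(u, v), (v, u)}\<rparr>"] exI[of _ "{u, v}"]) auto
next
  case (Suc c)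
  obtain H Y where first: "pair_graph H" "pverts H \<inter> F = {}" "bridge_depth H \<le> Suc c"
    "minimal_blocking_set H Y" "anchored H Y" "card Y = 2 ^ Suc c"
    using Suc.IH[OF Suc.prems] by blast
  \<comment> \<open>Avoiding \<open>pverts H\<close> as well makes the second graph disjoint from
    the first.\<close>
  have "finite (F \<union> pverts H)" using Suc.prems first(1) by (simp add: pair_graph_iff)
  from Suc.IH[OF this]
  obtain K Z where second: "pair_graph K" "pverts K \<inter> (F \<union> pverts H) = {}" "bridge_depth K \<le> Suc c"
    "minimal_blocking_set K Z" "anchored K Z" "card Z = 2 ^ Suc c"
    by blast
  let ?W = "F \<union> pverts H \<union> pverts K"
  have fin: "finite ?W" using Suc.prems first(1) second(1) by (simp add: pair_graph_iff)
  obtain u where u: "u \<notin> ?W" using ex_new_if_finite[OF assms(1) fin] by blast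
  obtain v where v: "v \<notin> insert u ?W"
    using ex_new_if_finite[OF assms(1), of "insert u ?W"] fin by blast
  \<comment> \<open>Indexing by \<open>Suc c\<close> makes both sizes at least 2, as the join
    requires.\<close>
  have "2 \<le> card Y" "2 \<le> card Z" unfolding first(6) second(6) by simp_all
  moreover have "pverts H \<inter> pverts K = {}" "{u, v} \<inter> (pverts H \<union> pverts K) = {}" "u \<noteq> v"
    using second(2) u v by blast+
  ultimately interpret joinable H Y u v Z K
    using first(1,4,5) second(1,4,5) by (intro joinable.intro)
  have "{u, v} \<inter> F = {}" "pverts K \<inter> F = {}" using second(2) u v by blast+
  then have "pverts J \<inter> F = {}"
    using first(2) by (simp add: bridge_join_def Int_Un_distrib2)
  moreover have "bridge_depth J \<le> Suc (Suc c)" using bridge_depth_J first(3) second(3) by linarith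
  moreover have "card (Y \<union> Z) = 2 ^ Suc (Suc c)"
  proof -
    have "finite Y" "finite Z"
      using first(1) second(1) subsets by (auto simp: pair_graph_iff intro: finite_subset)
    then show ?thesis
      using first(6) second(6) subsets disjoint(1) by (subst card_Un_disjoint) auto
  qed
  ultimately show ?case
    using pair_graph_J minimal_blocking_set_J anchored_J by blast
qed

theorem theorem27:
  fixes c :: nat
  assumes "c \<ge> 1"
  shows "\<exists>(G :: nat pair_pre_digraph) Y.
           pair_graph G \<and> bridge_depth G \<le> c \<and> minimal_blocking_set G Y \<and> card Y = 2 ^ c"
proof -
  \<comment> \<open>The construction starts with a single edge, that is, at exponent 1.\<close>
  obtain d where "c = Suc d" using assms by (cases c) auto
  then show ?thesis
    using exists_anchored_blocking_graph[OF infinite_UNIV_nat finite.emptyI, of d] by blast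
qed

end
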